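(* Let $A$ be a ring with $1$, $\sigma$ a ring endomorphism of $A$, $\delta$ a $\sigma$-derivation of $A$, and $R=A[t;\sigma,\delta]$. Let $f(t)\in R$ be a monic polynomial of degree $n>0$ and let $g(t)=g_0+g_1t+\dots+g_rt^r\in R$ be a monic polynomial of degree $r$ (so $g_r=1$) such that $f(t)\in Rg(t)$. Let $C\subseteq A^n$ be the cyclic $(f,\sigma,\delta)$-code corresponding to $Rg/Rf$. Then: (a) $C$ is a free left $A$-module of dimension $n-r$ (i.e. it has a basis with $n-r$ elements). (b) If $v=(a_0,a_1,\dots,a_{n-1})\in C$, then $T_f(v)\in C$. (c) The rows of a matrix generating the code $C$ are given by $(T_f)^k(g_0,g_1,\dots,g_r,0,\dots,0)$ for $0\le k\le n-r-1$.
   Context: A $\sigma$-derivation of $A$ is an additive map $\delta:A\to A$ with $\delta(ab)=\sigma(a)\delta(b)+\delta(a)b$ for all $a,b\in A$. Ring endomorphisms are unital. The skew polynomial (Ore) ring $R=A[t;\sigma,\delta]$ consists of the polynomials $\sum a_it^i$ with coefficients $a_i\in A$ written on the left, with usual addition and with multiplication determined by $ta=\sigma(a)t+\delta(a)$ for $a\in A$. Degree is as for usual polynomials; monic means leading coefficient $1$. For $f(t)=\sum_{i=0}^{n}a_it^i$ monic of degree $n$, the companion matrix $C_f\in M_n(A)$ has rows $e_2,e_3,\dots,e_n$ (standard basis row vectors) and last row $(-a_0,-a_1,\dots,-a_{n-1})$. The map $T_f:A^n\to A^n$ is $T_f(x_1,\dots,x_n)=(\sigma(x_1),\dots,\sigma(x_n))C_f+(\delta(x_1),\dots,\delta(x_n))$;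 elements of $A^n$ are row vectors and $A^n$ is a left $A$-module. Since $f$ is monic of degree $n$, every class in the left $R$-module $R/Rf$ has a unique representative $\sum_{i=0}^{n-1}c_it^i$. For a monic $g$ with $f\in Rg$, the cyclic $(f,\sigma,\delta)$-code corresponding to $Rg/Rf$ is the set $C\subseteq A^n$ of coordinate vectors $(c_0,\dots,c_{n-1})$, in the basis $1,t,\dots,t^{n-1}$, of the elements of $Rg/Rf\subseteq R/Rf$. A matrix generating the code $C$ is a matrix whose rows form a basis of $C$ as a left $A$-module. In (c), the vector $(g_0,\dots,g_r,0,\dots,0)$ has length $n$; when $r=n$ the list in (c) is empty. *)

theory Defs
  imports
    "HOL-Computational_Algebra.Polynomial"
    "HOL-Algebra.Ideal"
    "Jordan_Normal_Form.Matrix"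
begin

definition sigma_derivation :: "('a::ring_1 \<Rightarrow> 'a) \<Rightarrow> ('a \<Rightarrow> 'a) \<Rightarrow> bool" where
  "sigma_derivation \<sigma> \<delta> \<longleftrightarrow>
     (\<forall>a b. \<delta> (a + b) = \<delta> a + \<delta> b) \<and>
     (\<forall>a b. \<delta> (a * b) = \<sigma> a * \<delta> b + \<delta> a * b)"

section \<open>The skew polynomial ring\<close>

text \<open>
  The coefficient ring is not commutative, so \<open>'a poly\<close> carries no multiplication of its own;
  only its additive structure, \<^const>\<open>coeff\<close> and \<^const>\<open>degree\<close> are used. A polynomial
  \<open>p\<close> stands for the sum of the \<open>coeff p i * t ^ i\<close>, coefficients on the left.
\<close>

definition left_scale :: "'a::ring_1 \<Rightarrow> 'a poly \<Rightarrow> 'a poly" where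
  "left_scale a p = map_poly ((*) a) p"

text \<open>Left multiplication by \<open>t\<close>:
  \<open>t * (\<Sum>i. b\<^sub>i * t ^ i) = (\<Sum>i. \<sigma> b\<^sub>i * t ^ (i + 1)) + (\<Sum>i. \<delta> b\<^sub>i * t ^ i)\<close>.\<close>

definition skew_t_mult :: "('a::ring_1 \<Rightarrow> 'a) \<Rightarrow> ('a \<Rightarrow> 'a) \<Rightarrow> 'a poly \<Rightarrow> 'a poly" where
  "skew_t_mult \<sigma> \<delta> q = pCons 0 (map_poly \<sigma> q) + map_poly \<delta> q"

definition skew_mult :: "('a::ring_1 \<Rightarrow> 'a) \<Rightarrow> ('a \<Rightarrow> 'a) \<Rightarrow> 'a poly \<Rightarrow> 'a poly \<Rightarrow> 'a poly" where
  "skew_mult \<sigma> \<delta> p q = (\<Sum>i\<le>degree p. left_scale (coeff p i) ((skew_t_mult \<sigma> \<delta> ^^ i) q))"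

definition skew_poly_ring :: "('a::ring_1 \<Rightarrow> 'a) \<Rightarrow> ('a \<Rightarrow> 'a) \<Rightarrow> 'a poly ring" where
  "skew_poly_ring \<sigma> \<delta> =
     \<lparr>carrier = UNIV, mult = skew_mult \<sigma> \<delta>, one = [:1:], zero = 0, add = (+)\<rparr>"

lemma skew_poly_ring_simps [simp]:
  "carrier (skew_poly_ring \<sigma> \<delta>) = UNIV"
  "p \<otimes>\<^bsub>skew_poly_ring \<sigma> \<delta>\<^esub> q = skew_mult \<sigma> \<delta> p q"
  "\<one>\<^bsub>skew_poly_ring \<sigma> \<delta>\<^esub> = [:1:]"
  "\<zero>\<^bsub>skew_poly_ring \<sigma> \<delta>\<^esub> = 0"
  "p \<oplus>\<^bsub>skew_poly_ring \<sigma> \<delta>\<^esub> q = p + q"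
  by (simp_all add: skew_poly_ring_def)

lemma coeff_left_scale [simp]: "coeff (left_scale a p) i = a * coeff p i"
  by (simp add: left_scale_def coeff_map_poly)

context
  fixes \<sigma> \<delta> :: "'a::ring_1 \<Rightarrow> 'a"
  assumes \<sigma>: "Ring_Hom.ring_hom \<sigma>" and \<delta>: "sigma_derivation \<sigma> \<delta>"
begin

interpretation \<sigma>: Ring_Hom.ring_hom \<sigma> by (fact \<sigma>)

lemma sigma_derivation_add: "\<delta> (a + b) = \<delta> a + \<delta> b"
  and sigma_derivation_mult: "\<delta> (a * b) = \<sigma> a * \<delta> b + \<delta> a * b"
  using \<delta> by (auto simp: sigma_derivation_def)

lemma sigma_derivation_0: "\<delta> 0 = 0"
  using sigma_derivation_add[of 0 0] by simp

lemma sigma_derivation_1: "\<delta> 1 = 0"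
  using sigma_derivation_mult[of 1 1] by simp

lemma coeff_skew_t_mult:
  "coeff (skew_t_mult \<sigma> \<delta> q) i = (case i of 0 \<Rightarrow> 0 | Suc j \<Rightarrow> \<sigma> (coeff q j)) + \<delta> (coeff q i)"
  by (simp add: skew_t_mult_def coeff_pCons coeff_map_poly sigma_derivation_0 split: nat.split)

lemma skew_t_mult_add: "skew_t_mult \<sigma> \<delta> (p + q) = skew_t_mult \<sigma> \<delta> p + skew_t_mult \<sigma> \<delta> q"
  by (rule poly_eqI)
    (simp add: coeff_skew_t_mult sigma_derivation_add \<sigma>.hom_add algebra_simps split: nat.split)

lemma skew_t_mult_0: "skew_t_mult \<sigma> \<delta> 0 = 0"
  by (rule poly_eqI) (simp add: coeff_skew_t_mult sigma_derivation_0 split: nat.split)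

lemma skew_t_mult_left_scale:
  "skew_t_mult \<sigma> \<delta> (left_scale a p) =
     left_scale (\<sigma> a) (skew_t_mult \<sigma> \<delta> p) + left_scale (\<delta> a) p"
  by (rule poly_eqI)
    (simp add: coeff_skew_t_mult sigma_derivation_mult \<sigma>.hom_mult algebra_simps split: nat.split)

lemma skew_t_mult_monom:
  "skew_t_mult \<sigma> \<delta> (monom a i) = monom (\<sigma> a) (Suc i) + monom (\<delta> a) i"
  by (rule poly_eqI) (auto simp: coeff_skew_t_mult sigma_derivation_0 split: nat.split)

lemma skew_t_mult_funpow_add:
  "(skew_t_mult \<sigma> \<delta> ^^ i) (p + q) = (skew_t_mult \<sigma> \<delta> ^^ i) p + (skew_t_mult \<sigma> \<delta> ^^ i) q"
  by (induction i) (simp_all add: skew_t_mult_add)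

lemma left_scale_add: "left_scale a (p + q) = left_scale a p + left_scale a q"
  and left_scale_add_left: "left_scale (a + b) p = left_scale a p + left_scale b p"
  and left_scale_left_scale: "left_scale a (left_scale b p) = left_scale (a * b) p"
  and left_scale_0: "left_scale 0 p = 0"
  and left_scale_1: "left_scale 1 p = p"
  and left_scale_monom: "left_scale a (monom b i) = monom (a * b) i"
  by (rule poly_eqI; simp add: algebra_simps)+

lemma skew_mult_extend:
  assumes "degree p \<le> m"
  shows "skew_mult \<sigma> \<delta> p q = (\<Sum>i\<le>m. left_scale (coeff p i) ((skew_t_mult \<sigma> \<delta> ^^ i) q))"
  unfolding skew_mult_def using assms
  by (intro sum.mono_neutral_left) (auto simp: left_scale_0 coeff_eq_0)

lemma skew_mult_add_left: "skew_mult \<sigma> \<delta> (p + q) s = skew_mult \<sigma> \<delta> p s + skew_mult \<sigma> \<delta> q s"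
proof -
  define m where "m = max (degree p) (degree q)"
  have "degree (p + q) \<le> m" "degree p \<le> m" "degree q \<le> m"
    by (auto simp: m_def degree_add_le_max)
  then show ?thesis
    by (simp add: skew_mult_extend left_scale_add_left sum.distrib)
qed

lemma skew_mult_add_right: "skew_mult \<sigma> \<delta> s (p + q) = skew_mult \<sigma> \<delta> s p + skew_mult \<sigma> \<delta> s q"
  by (simp add: skew_mult_def skew_t_mult_funpow_add left_scale_add sum.distrib)

lemma skew_mult_monom:
  "skew_mult \<sigma> \<delta> (monom a i) q = left_scale a ((skew_t_mult \<sigma> \<delta> ^^ i) q)"
proof -
  have "skew_mult \<sigma> \<delta> (monom a i) q =
          (\<Sum>j\<le>i. left_scale (coeff (monom a i) j) ((skew_t_mult \<sigma> \<delta> ^^ j) q))"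
    by (rule skew_mult_extend) (rule degree_monom_le)
  also have "\<dots> = (\<Sum>j\<in>{i}. left_scale (coeff (monom a i) j) ((skew_t_mult \<sigma> \<delta> ^^ j) q))"
    by (intro sum.mono_neutral_right) (auto simp: left_scale_0)
  finally show ?thesis by simp
qed

lemma poly_add_monom_induct:
  fixes p :: "'a poly"
  assumes "\<And>a i. P (monom a i)" "\<And>p q. P p \<Longrightarrow> P q \<Longrightarrow> P (p + q)"
  shows "P p"
proof -
  have "P (\<Sum>i\<le>m. monom (coeff p i) i)" for m
    by (induction m) (auto intro: assms)
  then show ?thesis
    by (metis poly_as_sum_of_monoms)
qed

lemma skew_mult_skew_t_mult:
  "skew_mult \<sigma> \<delta> (skew_t_mult \<sigma> \<delta> q) s = skew_t_mult \<sigma> \<delta> (skew_mult \<sigma> \<delta> q s)"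
  by (induction q rule: poly_add_monom_induct)
    (simp_all add: skew_t_mult_add skew_mult_add_left skew_t_mult_monom skew_mult_monom
      skew_t_mult_left_scale)

lemma skew_mult_left_scale:
  "skew_mult \<sigma> \<delta> (left_scale a q) s = left_scale a (skew_mult \<sigma> \<delta> q s)"
  by (induction q rule: poly_add_monom_induct)
    (simp_all add: left_scale_add skew_mult_add_left skew_mult_monom left_scale_left_scale
      left_scale_monom)

lemma skew_mult_assoc:
  "skew_mult \<sigma> \<delta> (skew_mult \<sigma> \<delta> p q) s = skew_mult \<sigma> \<delta> p (skew_mult \<sigma> \<delta> q s)"
proof (induction p rule: poly_add_monom_induct)
  case (1 a i)
  have "skew_mult \<sigma> \<delta> ((skew_t_mult \<sigma> \<delta> ^^ i) q) s = (skew_t_mult \<sigma> \<delta> ^^ i) (skew_mult \<sigma> \<delta> q s)"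
    by (induction i) (simp_all add: skew_mult_skew_t_mult)
  then show ?case by (simp add: skew_mult_monom skew_mult_left_scale)
next
  case (2 p q)
  then show ?case by (simp add: skew_mult_add_left)
qed

lemma skew_t_mult_funpow_one: "(skew_t_mult \<sigma> \<delta> ^^ i) [:1:] = monom 1 i"
  by (induction i) (simp_all add: skew_t_mult_monom sigma_derivation_1 monom_0)

lemma skew_mult_one_left: "skew_mult \<sigma> \<delta> [:1:] p = p"
  using skew_mult_monom[of 1 0 p] by (simp add: monom_0 left_scale_1)

lemma skew_mult_one_right: "skew_mult \<sigma> \<delta> p [:1:] = p"
  by (induction p rule: poly_add_monom_induct)
    (simp_all add: skew_mult_add_left skew_mult_monom skew_t_mult_funpow_one left_scale_monom)

lemma ring_skew_poly_ring: "ring (skew_poly_ring \<sigma> \<delta>)"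
proof (intro ringI abelian_groupI monoidI)
  fix p :: "'a poly"
  show "\<exists>q\<in>carrier (skew_poly_ring \<sigma> \<delta>). q \<oplus>\<^bsub>skew_poly_ring \<sigma> \<delta>\<^esub> p = \<zero>\<^bsub>skew_poly_ring \<sigma> \<delta>\<^esub>"
    by (auto intro: exI[of _ "- p"])
qed (simp_all add: skew_mult_assoc skew_mult_one_left skew_mult_one_right skew_mult_add_left
      skew_mult_add_right algebra_simps)

text \<open>Elements are left polynomials in \<open>t = [:0, 1:]\<close>, subject to \<open>t * a = \<sigma> a * t + \<delta> a\<close>.\<close>

lemma skew_poly_ring_monom:
  "monom a i =
     [:a:] \<otimes>\<^bsub>skew_poly_ring \<sigma> \<delta>\<^esub> ([:0, 1:] [^]\<^bsub>skew_poly_ring \<sigma> \<delta>\<^esub> i)"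
proof -
  interpret ring "skew_poly_ring \<sigma> \<delta>" by (rule ring_skew_poly_ring)
  have t: "[:0, 1:] = (monom 1 1 :: 'a poly)" by (simp add: monom_Suc monom_0)
  have "[:0, 1:] [^]\<^bsub>skew_poly_ring \<sigma> \<delta>\<^esub> i = (monom 1 i :: 'a poly)"
  proof (induction i)
    case (Suc i)
    then show ?case
      using nat_pow_Suc2[of "[:0, 1:]" i]
      by (simp add: t skew_mult_monom skew_t_mult_monom sigma_derivation_1 left_scale_1)
  qed (simp add: monom_0)
  then show ?thesis
    using skew_mult_monom[of a 0] by (simp add: monom_0 left_scale_monom)
qed

lemma skew_poly_ring_commute:
  "[:0, 1:] \<otimes>\<^bsub>skew_poly_ring \<sigma> \<delta>\<^esub> [:a:] =
     [:\<sigma> a:] \<otimes>\<^bsub>skew_poly_ring \<sigma> \<delta>\<^esub> [:0, 1:] \<oplus>\<^bsub>skew_poly_ring \<sigma> \<delta>\<^esub> [:\<delta> a:]"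
proof -
  have t: "[:0, 1:] = (monom 1 1 :: 'a poly)" and c: "[:b:] = monom b 0" for b :: 'a
    by (simp_all add: monom_Suc monom_0)
  show ?thesis
    unfolding skew_poly_ring_simps t unfolding c
    by (simp add: skew_mult_monom left_scale_1 skew_t_mult_monom left_scale_monom)
qed

end

section \<open>The pseudo-linear map of a monic polynomial\<close>

definition skew_companion_mat :: "'a::ring_1 poly \<Rightarrow> 'a mat" where
  "skew_companion_mat f = mat (degree f) (degree f)
     (\<lambda>(i, j). if Suc i < degree f then (if j = Suc i then 1 else 0) else - coeff f j)"

text \<open>The product of the row vector \<open>x\<close> with \<open>M\<close>, entries of \<open>x\<close> on the left.\<close>

definition row_vec_mult_mat :: "'a::ring_1 vec \<Rightarrow> 'a mat \<Rightarrow> 'a vec" where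
  "row_vec_mult_mat x M = row (mat_of_row x * M) 0"

definition pseudo_linear_map ::
  "('a::ring_1 \<Rightarrow> 'a) \<Rightarrow> ('a \<Rightarrow> 'a) \<Rightarrow> 'a poly \<Rightarrow> 'a vec \<Rightarrow> 'a vec" where
  "pseudo_linear_map \<sigma> \<delta> f x =
     row_vec_mult_mat (map_vec \<sigma> x) (skew_companion_mat f) + map_vec \<delta> x"

section \<open>Cyclic codes\<close>

definition poly_of_coords :: "'a::ring_1 vec \<Rightarrow> 'a poly" where
  "poly_of_coords v = (\<Sum>i<dim_vec v. monom (v $ i) i)"

text \<open>
  In a noncommutative ring \<open>PIdl\<^bsub>R\<^esub> g\<close> is the principal left ideal \<open>Rg\<close>. The classes of
  \<open>R/Rf\<close> are the additive cosets \<open>Rf +> p\<close>, and \<open>Rg/Rf\<close> consists of those with \<open>p \<in> Rg\<close>.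
\<close>

definition left_ideal_quotient :: "('a, 'b) ring_scheme \<Rightarrow> 'a \<Rightarrow> 'a \<Rightarrow> 'a set set" where
  "left_ideal_quotient R g f = (\<lambda>p. (PIdl\<^bsub>R\<^esub> f) +>\<^bsub>R\<^esub> p) ` (PIdl\<^bsub>R\<^esub> g)"

definition cyclic_code ::
  "('a::ring_1 \<Rightarrow> 'a) \<Rightarrow> ('a \<Rightarrow> 'a) \<Rightarrow> 'a poly \<Rightarrow> 'a poly \<Rightarrow> 'a vec set" where
  "cyclic_code \<sigma> \<delta> f g =
     {c \<in> carrier_vec (degree f).
        (PIdl\<^bsub>skew_poly_ring \<sigma> \<delta>\<^esub> f) +>\<^bsub>skew_poly_ring \<sigma> \<delta>\<^esub> poly_of_coords c
          \<in> left_ideal_quotient (skew_poly_ring \<sigma> \<delta>) g f}"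

section \<open>Left submodules of \<open>A\<^sup>n\<close> and their bases\<close>

definition left_submodule :: "nat \<Rightarrow> 'a::ring_1 vec set \<Rightarrow> bool" where
  "left_submodule n C \<longleftrightarrow>
     C \<subseteq> carrier_vec n \<and> 0\<^sub>v n \<in> C \<and>
     (\<forall>u\<in>C. \<forall>v\<in>C. u + v \<in> C) \<and> (\<forall>a. \<forall>v\<in>C. a \<cdot>\<^sub>v v \<in> C)"

definition left_lincomb :: "nat \<Rightarrow> 'a::ring_1 vec \<Rightarrow> 'a vec list \<Rightarrow> 'a vec" where
  "left_lincomb n a vs = vec n (\<lambda>j. \<Sum>i<length vs. (a $ i \<cdot>\<^sub>v (vs ! i)) $ j)"

definition left_span :: "nat \<Rightarrow> 'a::ring_1 vec list \<Rightarrow> 'a vec set" where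
  "left_span n vs = {left_lincomb n a vs |a. a \<in> carrier_vec (length vs)}"

definition left_independent :: "nat \<Rightarrow> 'a::ring_1 vec list \<Rightarrow> bool" where
  "left_independent n vs \<longleftrightarrow>
     (\<forall>a\<in>carrier_vec (length vs). left_lincomb n a vs = 0\<^sub>v n \<longrightarrow> a = 0\<^sub>v (length vs))"

definition left_basis :: "nat \<Rightarrow> 'a::ring_1 vec set \<Rightarrow> 'a vec list \<Rightarrow> bool" where
  "left_basis n C vs \<longleftrightarrow>
     left_submodule n C \<and> set vs \<subseteq> C \<and> left_independent n vs \<and> left_span n vs = C"

text \<open>The rank of a free module over a noncommutative ring need not be unique, so the number of
  basis elements is a relation rather than a function of the module.\<close>

definition free_left_module_of_dim :: "nat \<Rightarrow> 'a::ring_1 vec set \<Rightarrow> nat \<Rightarrow> bool" where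
  "free_left_module_of_dim n C k \<longleftrightarrow>
     left_submodule n C \<and> (\<exists>vs. length vs = k \<and> left_basis n C vs)"

definition generating_mat :: "nat \<Rightarrow> 'a::ring_1 vec set \<Rightarrow> 'a mat \<Rightarrow> bool" where
  "generating_mat n C G \<longleftrightarrow> dim_col G = n \<and> left_basis n C (rows G)"

end

(* The coordinate map identifies C with the polynomials of degree < n in Rg, since Rf is contained
   in Rg. Under this identification T_f v becomes t v - \<sigma>(v_(n-1)) f, which gives (b), and as long
   as no degree overflow occurs T_f is plain multiplication by t, so T_f^k g = t^k g for k < n - r.
   As g is monic, deg (h g) = deg h + r for h \<noteq> 0, so right multiplication by g maps the polynomials
   of degree < n - r bijectively onto C, and 1, t, ..., t^(n-r-1) to the claimed basis. *)
theory Submission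
  imports Defs
begin

section \<open>Coordinate vectors and the polynomials they represent\<close>

lemma coeff_poly_of_coords: "coeff (poly_of_coords v) i = (if i < dim_vec v then v $ i else 0)"
  by (simp add: poly_of_coords_def coeff_sum coeff_monom if_distrib sum.delta cong: if_cong)

lemma poly_of_coords_vec_coeff:
  assumes "\<And>i. i \<ge> n \<Longrightarrow> coeff p i = 0"
  shows "poly_of_coords (vec n (coeff p)) = p"
  by (rule poly_eqI) (use assms in \<open>auto simp: coeff_poly_of_coords\<close>)

lemma poly_of_coords_0: "poly_of_coords (0\<^sub>v n) = 0"
  by (rule poly_eqI) (simp add: coeff_poly_of_coords)

lemma poly_of_coords_add:
  assumes "u \<in> carrier_vec n" "v \<in> carrier_vec n"
  shows "poly_of_coords (u + v) = poly_of_coords u + poly_of_coords v"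
  by (rule poly_eqI) (use assms in \<open>auto simp: coeff_poly_of_coords\<close>)

lemma poly_of_coords_smult: "poly_of_coords (a \<cdot>\<^sub>v v) = left_scale a (poly_of_coords v)"
  by (rule poly_eqI) (auto simp: coeff_poly_of_coords)

text \<open>The common length \<open>n\<close> is essential: trailing zeros of a vector leave no
  trace in its polynomial.\<close>

lemma poly_of_coords_inj:
  assumes "u \<in> carrier_vec n" "v \<in> carrier_vec n" "poly_of_coords u = poly_of_coords v"
  shows "u = v"
proof (rule eq_vecI)
  fix i assume "i < dim_vec v"
  moreover have "coeff (poly_of_coords u) i = coeff (poly_of_coords v) i"
    using assms(3) by simp
  ultimately show "u $ i = v $ i"
    using assms(1,2) by (simp add: coeff_poly_of_coords)
qed (use assms in auto)

lemma left_lincomb_carrier: "left_lincomb n a vs \<in> carrier_vec n"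
  by (simp add: left_lincomb_def)

lemma poly_of_coords_left_lincomb:
  assumes "set vs \<subseteq> carrier_vec n"
  shows "poly_of_coords (left_lincomb n a vs) =
    (\<Sum>i<length vs. left_scale (a $ i) (poly_of_coords (vs ! i)))"
proof (rule poly_eqI)
  fix j
  \<comment> \<open>All vectors have length exactly \<open>n\<close>, so the cutoff in
    \<open>left_lincomb\<close> and the cutoffs in the summands coincide.\<close>
  have dim: "dim_vec (vs ! i) = n" if "i < length vs" for i
    using assms that nth_mem by fastforce
  then show "coeff (poly_of_coords (left_lincomb n a vs)) j =
      coeff (\<Sum>i<length vs. left_scale (a $ i) (poly_of_coords (vs ! i))) j"
    by (auto simp: coeff_poly_of_coords left_lincomb_def coeff_sum intro!: sum.cong)
qed

section \<open>The action of the companion matrix on row vectors\<close>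

lemma pseudo_linear_map_carrier:
  assumes "v \<in> carrier_vec (degree f)"
  shows "pseudo_linear_map \<sigma> \<delta> f v \<in> carrier_vec (degree f)"
  by (rule carrier_vecI)
    (simp add: pseudo_linear_map_def row_vec_mult_mat_def skew_companion_mat_def
      carrier_vecD[OF assms])

text \<open>Column \<open>j\<close> of the matrix has at most two sources of nonzero entries: the 1
  in row \<open>j - 1\<close>, absent for \<open>j = 0\<close>, and \<open>- coeff f j\<close> in
  the last row.\<close>

lemma row_vec_mult_skew_companion_mat:
  assumes "x \<in> carrier_vec (degree f)" "j < degree f"
  shows "row_vec_mult_mat x (skew_companion_mat f) $ j =
    (case j of 0 \<Rightarrow> 0 | Suc i \<Rightarrow> x $ i) - x $ (degree f - 1) * coeff f j"
proof -
  \<comment> \<open>With the degree written as \<open>Suc m\<close>, the sum over the rows splits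
    off the last row, the only one that involves \<open>f\<close>.\<close>
  define m where "m = degree f - 1"
  have n: "degree f = Suc m"
    using assms(2) by (simp add: m_def)
  have "row_vec_mult_mat x (skew_companion_mat f) $ j =
      (\<Sum>i<Suc m. x $ i * (if i < m then (if j = Suc i then 1 else 0) else - coeff f j))"
    using assms n
    by (auto simp: row_vec_mult_mat_def skew_companion_mat_def scalar_prod_def mat_of_row_def
        atLeast0LessThan intro!: sum.cong simp del: sum.lessThan_Suc)
  also have "\<dots> = (\<Sum>i<m. if j = Suc i then x $ i else 0) - x $ m * coeff f j"
    by (auto intro!: sum.cong)
  also have "(\<Sum>i<m. if j = Suc i then x $ i else 0) = (case j of 0 \<Rightarrow> 0 | Suc i \<Rightarrow> x $ i)"
    using assms(2) n by (auto split: nat.split)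
  finally show ?thesis
    by (simp add: m_def)
qed

section \<open>Left ideals, and the code as a set of polynomials\<close>

context
  fixes \<sigma> \<delta> :: "'a::ring_1 \<Rightarrow> 'a"
  assumes \<sigma>: "Ring_Hom.ring_hom \<sigma>" and \<delta>: "sigma_derivation \<sigma> \<delta>"
begin

interpretation \<sigma>: Ring_Hom.ring_hom \<sigma> by (fact \<sigma>)

interpretation R: ring "skew_poly_ring \<sigma> \<delta>" by (rule ring_skew_poly_ring[OF \<sigma> \<delta>])

lemma skew_mult_0_left: "skew_mult \<sigma> \<delta> 0 p = 0"
  using R.l_null[of p] by simp

lemma skew_mult_minus_left: "skew_mult \<sigma> \<delta> (- p) q = - skew_mult \<sigma> \<delta> p q"
  using skew_mult_add_left[OF \<sigma> \<delta>, of "- p" p q]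
  by (simp add: skew_mult_0_left eq_neg_iff_add_eq_0)

lemma mem_PIdl_iff: "p \<in> PIdl\<^bsub>skew_poly_ring \<sigma> \<delta>\<^esub> g \<longleftrightarrow> (\<exists>h. p = skew_mult \<sigma> \<delta> h g)"
  by (auto simp: cgenideal_def)

lemma PIdl_0: "0 \<in> PIdl\<^bsub>skew_poly_ring \<sigma> \<delta>\<^esub> g"
  using skew_mult_0_left by (force simp: mem_PIdl_iff)

lemma PIdl_add:
  assumes "p \<in> PIdl\<^bsub>skew_poly_ring \<sigma> \<delta>\<^esub> g" "q \<in> PIdl\<^bsub>skew_poly_ring \<sigma> \<delta>\<^esub> g"
  shows "p + q \<in> PIdl\<^bsub>skew_poly_ring \<sigma> \<delta>\<^esub> g"
  using assms by (metis mem_PIdl_iff skew_mult_add_left[OF \<sigma> \<delta>])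

lemma PIdl_minus:
  assumes "p \<in> PIdl\<^bsub>skew_poly_ring \<sigma> \<delta>\<^esub> g"
  shows "- p \<in> PIdl\<^bsub>skew_poly_ring \<sigma> \<delta>\<^esub> g"
  using assms by (metis mem_PIdl_iff skew_mult_minus_left)

lemma PIdl_left_scale:
  assumes "p \<in> PIdl\<^bsub>skew_poly_ring \<sigma> \<delta>\<^esub> g"
  shows "left_scale a p \<in> PIdl\<^bsub>skew_poly_ring \<sigma> \<delta>\<^esub> g"
  using assms by (metis mem_PIdl_iff skew_mult_left_scale[OF \<sigma> \<delta>])

lemma PIdl_skew_t_mult:
  assumes "p \<in> PIdl\<^bsub>skew_poly_ring \<sigma> \<delta>\<^esub> g"
  shows "skew_t_mult \<sigma> \<delta> p \<in> PIdl\<^bsub>skew_poly_ring \<sigma> \<delta>\<^esub> g"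
  using assms by (metis mem_PIdl_iff skew_mult_skew_t_mult[OF \<sigma> \<delta>])

lemma PIdl_mono:
  assumes "f \<in> PIdl\<^bsub>skew_poly_ring \<sigma> \<delta>\<^esub> g"
  shows "PIdl\<^bsub>skew_poly_ring \<sigma> \<delta>\<^esub> f \<subseteq> PIdl\<^bsub>skew_poly_ring \<sigma> \<delta>\<^esub> g"
  using assms by (auto simp: mem_PIdl_iff) (metis skew_mult_assoc[OF \<sigma> \<delta>])

text \<open>A coset fixes its representative only up to Rf, and Rf lies in Rg, so all
  representatives lie in Rg as soon as one does.\<close>

lemma coset_in_left_ideal_quotient_iff:
  assumes "f \<in> PIdl\<^bsub>skew_poly_ring \<sigma> \<delta>\<^esub> g"
  shows "PIdl\<^bsub>skew_poly_ring \<sigma> \<delta>\<^esub> f +>\<^bsub>skew_poly_ring \<sigma> \<delta>\<^esub> p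
      \<in> left_ideal_quotient (skew_poly_ring \<sigma> \<delta>) g f \<longleftrightarrow>
    p \<in> PIdl\<^bsub>skew_poly_ring \<sigma> \<delta>\<^esub> g"
    (is "?I +>\<^bsub>_\<^esub> p \<in> _ \<longleftrightarrow> p \<in> ?J")
proof
  assume "?I +>\<^bsub>skew_poly_ring \<sigma> \<delta>\<^esub> p \<in> left_ideal_quotient (skew_poly_ring \<sigma> \<delta>) g f"
  then obtain q where q: "q \<in> ?J"
    and eq: "?I +>\<^bsub>skew_poly_ring \<sigma> \<delta>\<^esub> p = ?I +>\<^bsub>skew_poly_ring \<sigma> \<delta>\<^esub> q"
    by (auto simp: left_ideal_quotient_def)
  have "p \<in> ?I +>\<^bsub>skew_poly_ring \<sigma> \<delta>\<^esub> p"
    using PIdl_0 by (force simp: a_r_coset_def')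
  then obtain h where "h \<in> ?I" "p = h + q"
    unfolding eq by (auto simp: a_r_coset_def')
  then show "p \<in> ?J"
    using q PIdl_mono[OF assms] PIdl_add by blast
qed (auto simp: left_ideal_quotient_def)

text \<open>This removes the cosets: from here on, questions about the code are questions about left
  multiples of \<open>g\<close>.\<close>

lemma cyclic_code_eq:
  assumes "f \<in> PIdl\<^bsub>skew_poly_ring \<sigma> \<delta>\<^esub> g"
  shows "cyclic_code \<sigma> \<delta> f g =
    {c \<in> carrier_vec (degree f). poly_of_coords c \<in> PIdl\<^bsub>skew_poly_ring \<sigma> \<delta>\<^esub> g}"
  by (simp add: cyclic_code_def coset_in_left_ideal_quotient_iff[OF assms])

lemma left_submodule_cyclic_code:
  assumes "f \<in> PIdl\<^bsub>skew_poly_ring \<sigma> \<delta>\<^esub> g"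
  shows "left_submodule (degree f) (cyclic_code \<sigma> \<delta> f g)"
  by (auto simp: left_submodule_def cyclic_code_eq[OF assms] poly_of_coords_0 PIdl_0
      poly_of_coords_add PIdl_add poly_of_coords_smult PIdl_left_scale)

section \<open>The map \<open>T_f\<close> as multiplication by t modulo \<open>f\<close>\<close>

lemma poly_of_coords_pseudo_linear_map:
  assumes v: "v \<in> carrier_vec (degree f)" and deg: "degree f > 0" and monic: "lead_coeff f = 1"
  shows "poly_of_coords (pseudo_linear_map \<sigma> \<delta> f v) =
    skew_t_mult \<sigma> \<delta> (poly_of_coords v) - left_scale (\<sigma> (v $ (degree f - 1))) f"
proof (rule poly_eqI)
  fix j
  have \<delta>0: "\<delta> 0 = 0"
    by (rule sigma_derivation_0[OF \<sigma> \<delta>])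
  have dims: "dim_vec (pseudo_linear_map \<sigma> \<delta> f v) = degree f" "dim_vec v = degree f"
    using pseudo_linear_map_carrier[OF v] v by auto
  consider "j < degree f" | "j = degree f" | "j > degree f"
    by linarith
  then show "coeff (poly_of_coords (pseudo_linear_map \<sigma> \<delta> f v)) j =
      coeff (skew_t_mult \<sigma> \<delta> (poly_of_coords v) - left_scale (\<sigma> (v $ (degree f - 1))) f) j"
  proof cases
    case 1
    \<comment> \<open>Below the degree of \<open>f\<close>, the superdiagonal of the companion
      matrix is the shift in multiplication by t, and its last row subtracts the multiple of
      \<open>f\<close>.\<close>
    have "map_vec \<sigma> v \<in> carrier_vec (degree f)"
      using v by simp
    from row_vec_mult_skew_companion_mat[OF this 1] 1 dims show ?thesis
      by (simp add: coeff_poly_of_coords coeff_skew_t_mult[OF \<sigma> \<delta>] pseudo_linear_map_def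
          split: nat.split)
  next
    case 2
    \<comment> \<open>The shift puts \<sigma> of the last entry of \<open>v\<close> here; it cancels
      because \<open>f\<close> is monic, and the \<delta> part is \<delta> 0 = 0.\<close>
    then show ?thesis
      using deg monic dims
      by (auto simp: coeff_poly_of_coords coeff_skew_t_mult[OF \<sigma> \<delta>] \<delta>0 split: nat.split)
  next
    case 3
    then show ?thesis
      using dims
      by (auto simp: coeff_poly_of_coords coeff_skew_t_mult[OF \<sigma> \<delta>] \<delta>0 coeff_eq_0
          split: nat.split)
  qed
qed

text \<open>Rg contains \<open>f\<close> and is closed under left multiplication by t and by
  scalars, so it contains both terms of the formula for \<open>T_f\<close>.\<close>

lemma pseudo_linear_map_cyclic_code:
  assumes "f \<in> PIdl\<^bsub>skew_poly_ring \<sigma> \<delta>\<^esub> g" "degree f > 0" "lead_coeff f = 1"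
    and "v \<in> cyclic_code \<sigma> \<delta> f g"
  shows "pseudo_linear_map \<sigma> \<delta> f v \<in> cyclic_code \<sigma> \<delta> f g"
  using assms PIdl_add[OF PIdl_skew_t_mult PIdl_minus[OF PIdl_left_scale]]
  by (simp add: cyclic_code_eq pseudo_linear_map_carrier poly_of_coords_pseudo_linear_map)

section \<open>Leading coefficients of products with a monic right factor\<close>

lemma coeff_skew_t_mult_funpow_eq_0:
  assumes "j > i + degree g"
  shows "coeff ((skew_t_mult \<sigma> \<delta> ^^ i) g) j = 0"
  using assms
  by (induction i arbitrary: j)
    (auto simp: coeff_eq_0 coeff_skew_t_mult[OF \<sigma> \<delta>] sigma_derivation_0[OF \<sigma> \<delta>] split: nat.split)

text \<open>Each multiplication by t applies \<sigma> to the leading coefficient. A 1 survives this,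
  whereas a general coefficient could be killed, \<sigma> being possibly not injective.\<close>

lemma coeff_skew_t_mult_funpow_top:
  assumes "lead_coeff g = 1"
  shows "coeff ((skew_t_mult \<sigma> \<delta> ^^ i) g) (i + degree g) = 1"
  using assms
  by (induction i)
    (auto simp: coeff_skew_t_mult[OF \<sigma> \<delta>] sigma_derivation_0[OF \<sigma> \<delta>] coeff_skew_t_mult_funpow_eq_0)

text \<open>Only the top power of t in \<open>h\<close> reaches this degree, and there the
  coefficient of \<open>h\<close> is multiplied by 1, so zero divisors do no harm.\<close>

lemma coeff_skew_mult_top:
  assumes "lead_coeff g = 1"
  shows "coeff (skew_mult \<sigma> \<delta> h g) (degree h + degree g) = lead_coeff h"
proof -
  have "coeff (skew_mult \<sigma> \<delta> h g) (degree h + degree g) =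
      (\<Sum>i\<in>{degree h}.
        coeff h i * coeff ((skew_t_mult \<sigma> \<delta> ^^ i) g) (degree h + degree g))"
    unfolding skew_mult_def coeff_sum coeff_left_scale
    by (intro sum.mono_neutral_right) (auto simp: coeff_skew_t_mult_funpow_eq_0)
  then show ?thesis
    by (simp add: coeff_skew_t_mult_funpow_top[OF assms])
qed

lemma skew_mult_eq_0_iff:
  assumes "lead_coeff g = 1"
  shows "skew_mult \<sigma> \<delta> h g = 0 \<longleftrightarrow> h = 0"
  using coeff_skew_mult_top[OF assms, of h] skew_mult_0_left by auto

lemma coeff_eq_0_of_skew_mult:
  assumes "lead_coeff g = 1" "\<And>j. j \<ge> n \<Longrightarrow> coeff (skew_mult \<sigma> \<delta> h g) j = 0" "i \<ge> n - degree g"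
  shows "coeff h i = 0"
proof (cases "degree h + degree g < n")
  case True
  with assms(3) show ?thesis
    by (simp add: coeff_eq_0)
next
  \<comment> \<open>Here the leading coefficient of \<open>h\<close> appears at an index where the
    product vanishes, so \<open>h = 0\<close>.\<close>
  case False
  with assms(2)[of "degree h + degree g"] coeff_skew_mult_top[OF assms(1), of h] show ?thesis
    by simp
qed

section \<open>Iterates of \<open>T_f\<close> on \<open>g\<close> and the basis of the code\<close>

lemma poly_of_coords_pseudo_linear_map_funpow:
  assumes "degree f > 0" "lead_coeff f = 1" "k < degree f - degree g"
  shows "(pseudo_linear_map \<sigma> \<delta> f ^^ k) (vec (degree f) (coeff g)) \<in> carrier_vec (degree f) \<and>
    poly_of_coords ((pseudo_linear_map \<sigma> \<delta> f ^^ k) (vec (degree f) (coeff g))) =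
      (skew_t_mult \<sigma> \<delta> ^^ k) g"
  using assms(3)
proof (induction k)
  case 0
  \<comment> \<open>The bound on \<open>k\<close> forces \<open>degree g < degree f\<close>, so
    cutting the coefficients of \<open>g\<close> off at \<open>degree f\<close> loses
    nothing.\<close>
  then show ?case
    by (auto intro!: poly_of_coords_vec_coeff coeff_eq_0)
next
  case (Suc k)
  define v where "v = (pseudo_linear_map \<sigma> \<delta> f ^^ k) (vec (degree f) (coeff g))"
  have v: "v \<in> carrier_vec (degree f)" "poly_of_coords v = (skew_t_mult \<sigma> \<delta> ^^ k) g"
    using Suc by (simp_all add: v_def)
  have "v $ (degree f - 1) = coeff (poly_of_coords v) (degree f - 1)"
    using v(1) assms(1) by (simp add: coeff_poly_of_coords)
  also have "\<dots> = 0"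
    \<comment> \<open>Since \<open>Suc k < degree f - degree g\<close>, the polynomial has degree
      below \<open>degree f - 1\<close>; hence no multiple of \<open>f\<close> is subtracted in the
      next step.\<close>
    using Suc.prems by (simp add: v(2) coeff_skew_t_mult_funpow_eq_0)
  finally show ?case
    using v poly_of_coords_pseudo_linear_map[OF v(1) assms(1,2)]
      pseudo_linear_map_carrier[OF v(1)]
    by (simp add: left_scale_0[OF \<sigma> \<delta>] flip: v_def)
qed

lemma left_basis_cyclic_code:
  assumes "degree f > 0" "lead_coeff f = 1" "lead_coeff g = 1"
    and f: "f \<in> PIdl\<^bsub>skew_poly_ring \<sigma> \<delta>\<^esub> g"
  shows "left_basis (degree f) (cyclic_code \<sigma> \<delta> f g)
    (map (\<lambda>k. (pseudo_linear_map \<sigma> \<delta> f ^^ k) (vec (degree f) (coeff g)))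
      [0..<degree f - degree g])"
proof -
  define n where "n = degree f"
  define m where "m = n - degree g"
  define vs where "vs = map (\<lambda>k. (pseudo_linear_map \<sigma> \<delta> f ^^ k) (vec n (coeff g))) [0..<m]"
  have [simp]: "length vs = m"
    by (simp add: vs_def)
  have carrier: "set vs \<subseteq> carrier_vec n"
    using poly_of_coords_pseudo_linear_map_funpow[OF assms(1,2)]
    by (auto simp: vs_def n_def m_def)
  have nth: "poly_of_coords (vs ! k) = (skew_t_mult \<sigma> \<delta> ^^ k) g" if "k < m" for k
    using poly_of_coords_pseudo_linear_map_funpow[OF assms(1,2)] that
    by (auto simp: vs_def n_def m_def)
  have lincomb: "poly_of_coords (left_lincomb n a vs) = skew_mult \<sigma> \<delta> (poly_of_coords a) g"
    if a: "a \<in> carrier_vec m" for a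
  proof -
    \<comment> \<open>The bound \<open>m\<close> instead of \<open>m - 1\<close> also covers
      \<open>m = 0\<close>; the additional term of the sum has coefficient 0.\<close>
    have deg: "degree (poly_of_coords a) \<le> m"
      using a by (intro degree_le) (auto simp: coeff_poly_of_coords)
    have "poly_of_coords (left_lincomb n a vs) =
        (\<Sum>i<m. left_scale (a $ i) ((skew_t_mult \<sigma> \<delta> ^^ i) g))"
      using poly_of_coords_left_lincomb[OF carrier] nth by simp
    also have "\<dots> = (\<Sum>i\<le>m. left_scale (coeff (poly_of_coords a) i) ((skew_t_mult \<sigma> \<delta> ^^ i) g))"
      using a
      by (auto simp: coeff_poly_of_coords left_scale_0[OF \<sigma> \<delta>] simp flip: lessThan_Suc_atMost)
    also have "\<dots> = skew_mult \<sigma> \<delta> (poly_of_coords a) g"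
      by (rule skew_mult_extend[OF \<sigma> \<delta> deg, symmetric])
    finally show ?thesis .
  qed
  have independent: "left_independent n vs"
    unfolding left_independent_def
  proof (intro ballI impI)
    fix a assume a: "a \<in> carrier_vec (length vs)" and "left_lincomb n a vs = 0\<^sub>v n"
    then have "skew_mult \<sigma> \<delta> (poly_of_coords a) g = 0"
      using lincomb[of a] by (simp add: poly_of_coords_0)
    then have "poly_of_coords a = poly_of_coords (0\<^sub>v (length vs))"
      by (simp add: skew_mult_eq_0_iff[OF assms(3)] poly_of_coords_0)
    with a show "a = 0\<^sub>v (length vs)"
      by (intro poly_of_coords_inj) auto
  qed
  have span: "left_span n vs = cyclic_code \<sigma> \<delta> f g"
  proof (intro equalityI subsetI)
    fix c assume "c \<in> left_span n vs"
    then obtain a where "a \<in> carrier_vec m" "c = left_lincomb n a vs"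
      by (auto simp: left_span_def)
    then show "c \<in> cyclic_code \<sigma> \<delta> f g"
      using lincomb left_lincomb_carrier by (auto simp: cyclic_code_eq[OF f] mem_PIdl_iff n_def)
  next
    fix c assume "c \<in> cyclic_code \<sigma> \<delta> f g"
    then obtain h where c: "c \<in> carrier_vec n" and h: "poly_of_coords c = skew_mult \<sigma> \<delta> h g"
      by (auto simp: cyclic_code_eq[OF f] mem_PIdl_iff n_def)
    \<comment> \<open>As the product fits into \<open>n\<close> coordinates, the cofactor
      \<open>h\<close> fits into \<open>m\<close>; its coefficients are the coordinates of
      \<open>c\<close> in the basis.\<close>
    have "coeff (skew_mult \<sigma> \<delta> h g) j = 0" if "j \<ge> n" for j
      using c that by (simp flip: h add: coeff_poly_of_coords)
    then have "poly_of_coords (vec m (coeff h)) = h"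
      using coeff_eq_0_of_skew_mult[OF assms(3)]
      by (auto intro!: poly_of_coords_vec_coeff simp: m_def)
    then have "poly_of_coords c = poly_of_coords (left_lincomb n (vec m (coeff h)) vs)"
      using lincomb[of "vec m (coeff h)"] h by simp
    then have "c = left_lincomb n (vec m (coeff h)) vs"
      by (intro poly_of_coords_inj[OF c left_lincomb_carrier])
    then show "c \<in> left_span n vs"
      by (auto simp: left_span_def)
  qed
  have "poly_of_coords (vs ! k) \<in> PIdl\<^bsub>skew_poly_ring \<sigma> \<delta>\<^esub> g" if "k < m" for k
    \<comment> \<open>The cofactor showing membership in Rg is the monomial t^k.\<close>
    using skew_mult_monom[OF \<sigma> \<delta>, of 1 k g] nth[OF that]
    by (metis left_scale_1[OF \<sigma> \<delta>] mem_PIdl_iff)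
  then have "set vs \<subseteq> cyclic_code \<sigma> \<delta> f g"
    using carrier by (auto simp: cyclic_code_eq[OF f] n_def in_set_conv_nth)
  with independent span left_submodule_cyclic_code[OF f] show ?thesis
    by (simp add: left_basis_def n_def m_def vs_def)
qed

end

theorem theorem3p2:
  fixes \<sigma> \<delta> :: "'a::ring_1 \<Rightarrow> 'a" and f g :: "'a poly" and n r :: nat and C :: "'a vec set"
  assumes "Ring_Hom.ring_hom \<sigma>"
    and "sigma_derivation \<sigma> \<delta>"
    and "degree f = n" and "n > 0" and "lead_coeff f = 1"
    and "degree g = r" and "lead_coeff g = 1"
    and "f \<in> PIdl\<^bsub>skew_poly_ring \<sigma> \<delta>\<^esub> g"
    and "C = cyclic_code \<sigma> \<delta> f g"
  shows "free_left_module_of_dim n C (n - r) \<and>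
    (\<forall>v\<in>C. pseudo_linear_map \<sigma> \<delta> f v \<in> C) \<and>
    generating_mat n C
      (mat_of_rows n
        (map (\<lambda>k. (pseudo_linear_map \<sigma> \<delta> f ^^ k) (vec n (coeff g))) [0..<n - r]))"
proof -
  define vs where "vs = map (\<lambda>k. (pseudo_linear_map \<sigma> \<delta> f ^^ k) (vec n (coeff g))) [0..<n - r]"
  have basis: "left_basis n C vs"
    using left_basis_cyclic_code[OF assms(1,2), of f g] assms by (simp add: vs_def)
  then have sub: "left_submodule n C" and "set vs \<subseteq> carrier_vec n"
    by (auto simp: left_basis_def left_submodule_def)
  \<comment> \<open>Because all vectors have length \<open>n\<close>, the rows of the matrix are
    again the list \<open>vs\<close>.\<close>
  then have "generating_mat n C (mat_of_rows n vs)"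
    using basis by (simp add: generating_mat_def rows_mat_of_rows)
  moreover have "free_left_module_of_dim n C (n - r)"
    using basis sub by (auto simp: free_left_module_of_dim_def vs_def intro!: exI[of _ vs])
  moreover have "\<forall>v\<in>C. pseudo_linear_map \<sigma> \<delta> f v \<in> C"
    using pseudo_linear_map_cyclic_code[OF assms(1,2,8)] assms by blast
  ultimately show ?thesis
    by (simp add: vs_def)
qed

end
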